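(* Let $X$ be a compact metric space and let $\mathcal K\subset\mathfrak M_+(X)$ satisfy: (a) $\mathcal K$ is nonempty, convex and weakly closed in $\mathfrak M_+(X)$; (b) if $\nu\in\mathcal K$, $\tau\in\mathfrak M_+(X)$ and $\tau\le\nu$, then $\tau\in\mathcal K$. Then every $\mu\in\mathfrak M_+(X)$ that vanishes on $\mathcal K$-null sets is of the form $\mu=\sup_{n\ge1}n\,\nu_n$, where $\nu_n\in\mathcal K$ for all $n\ge1$ and $\{n\nu_n\}_{n\ge1}$ is an increasing sequence in $\mathfrak M_+(X)$.
   Context: $\mathfrak M_+(X)$ is the set of all finite nonnegative Borel measures on $X$. Weakly closed refers to the weak topology on measures defined by duality with $C(X;\mathbb R)$. A Borel set $A\subset X$ is $\mathcal K$-null if $\tau(A)=0$ for all $\tau\in\mathcal K$. The order on $\mathfrak M_+(X)$ is the setwise one. *)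

theory Defs
  imports "HOL-Analysis.Analysis"
begin

definition finite_borel_measures :: "'a::topological_space set \<Rightarrow> 'a measure set" where
  "finite_borel_measures X =
     {\<mu>. finite_measure \<mu> \<and> sets \<mu> = sets (restrict_space borel X)}"

text \<open>The initial topology on the finite Borel measures on \<open>X\<close> for the functionals
  \<open>\<mu> \<mapsto> \<integral>f d\<mu>\<close> with \<open>f\<close> in \<open>C(X; \<real>)\<close>. Functions on \<open>X\<close> are represented by functions
  on the ambient type; only their restriction to \<open>X\<close> matters.\<close>

definition weak_measure_topology :: "'a::topological_space set \<Rightarrow> 'a measure topology" where
  "weak_measure_topology X = topology_generated_by
     {{\<mu> \<in> finite_borel_measures X. (LINT x|\<mu>. f x) \<in> U} | (f :: 'a \<Rightarrow> real) U.
        continuous_on X f \<and> open U}"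

lemma topspace_weak_measure_topology:
  "topspace (weak_measure_topology X) = finite_borel_measures X"
proof -
  have "finite_borel_measures X \<in>
      {{\<mu> \<in> finite_borel_measures X. (LINT x|\<mu>. f x) \<in> U} | (f :: 'a \<Rightarrow> real) U.
        continuous_on X f \<and> open U}"
    by (intro CollectI exI[of _ "\<lambda>_. 0"] exI[of _ UNIV]) auto
  then show ?thesis
    unfolding weak_measure_topology_def topology_generated_by_topspace by auto
qed

text \<open>Only meaningful for measures with the same measurable sets.\<close>

definition add_measure :: "'a measure \<Rightarrow> 'a measure \<Rightarrow> 'a measure" where
  "add_measure \<mu> \<nu> = measure_of (space \<mu>) (sets \<mu>) (\<lambda>A. emeasure \<mu> A + emeasure \<nu> A)"

lemma sets_add_measure [simp]: "sets (add_measure \<mu> \<nu>) = sets \<mu>"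
  by (simp add: add_measure_def)

lemma emeasure_add_measure:
  assumes "sets \<nu> = sets \<mu>"
  shows "emeasure (add_measure \<mu> \<nu>) A = emeasure \<mu> A + emeasure \<nu> A"
proof (cases "A \<in> sets \<mu>")
  case True
  have "countably_additive (sets \<mu>) (\<lambda>A. emeasure \<mu> A + emeasure \<nu> A)"
    unfolding countably_additive_def
  proof (intro allI impI)
    fix B :: "nat \<Rightarrow> 'a set"
    assume "range B \<subseteq> sets \<mu>" "disjoint_family B"
    then show "(\<Sum>i. emeasure \<mu> (B i) + emeasure \<nu> (B i)) =
        emeasure \<mu> (\<Union>i. B i) + emeasure \<nu> (\<Union>i. B i)"
      using assms by (simp add: suminf_add[symmetric] suminf_emeasure)
  qed
  then show ?thesis
    unfolding add_measure_def using True
    by (intro emeasure_measure_of_sigma)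
       (auto simp: positive_def sets.sigma_algebra_axioms)
next
  case False
  then show ?thesis using assms by (simp add: emeasure_notin_sets)
qed

definition convex_measures :: "'a measure set \<Rightarrow> bool" where
  "convex_measures K \<longleftrightarrow>
     (\<forall>\<mu>\<in>K. \<forall>\<nu>\<in>K. \<forall>u\<ge>0. \<forall>v\<ge>0. u + v = (1::real) \<longrightarrow>
        add_measure (scale_measure (ennreal u) \<mu>) (scale_measure (ennreal v) \<nu>) \<in> K)"

definition null_for :: "'a::topological_space set \<Rightarrow> 'a measure set \<Rightarrow> 'a set \<Rightarrow> bool" where
  "null_for X K A \<longleftrightarrow>
     A \<in> sets (restrict_space borel X) \<and> (\<forall>\<tau>\<in>K. emeasure \<tau> A = 0)"

text \<open>The library order on measures compares spaces and measurable sets first. On the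
  measures considered here it is the setwise order, and suprema of increasing sequences
  are computed setwise.\<close>

lemma le_finite_borel_measures_iff:
  assumes "\<mu> \<in> finite_borel_measures X" "\<nu> \<in> finite_borel_measures X"
  shows "\<mu> \<le> \<nu> \<longleftrightarrow>
    (\<forall>A \<in> sets (restrict_space borel X). emeasure \<mu> A \<le> emeasure \<nu> A)"
proof -
  have "sets \<mu> = sets \<nu>" "sets \<mu> = sets (restrict_space borel X)"
    using assms by (auto simp: finite_borel_measures_def)
  then show ?thesis
    using le_measure[of \<mu> \<nu>] emeasure_notin_sets[of _ \<mu>]
    by (metis le_fun_def zero_le)
qed

lemma emeasure_SUP_finite_borel_measures:
  fixes \<rho> :: "nat \<Rightarrow> 'a::topological_space measure"
  assumes "\<And>n. n \<ge> 1 \<Longrightarrow> \<rho> n \<in> finite_borel_measures X" and "mono_on {1..} \<rho>"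
    and "A \<in> sets (restrict_space borel X)"
  shows "emeasure (SUP n\<in>{1..}. \<rho> n) A = (SUP n\<in>{1..}. emeasure (\<rho> n) A)"
proof (rule emeasure_SUP_chain[where N = "restrict_space borel X"])
  show "Complete_Partial_Order.chain (\<le>) (\<rho> ` {1..})"
    unfolding Complete_Partial_Order.chain_def
  proof (intro ballI)
    fix x y
    assume "x \<in> \<rho> ` {1..}" "y \<in> \<rho> ` {1..}"
    then obtain m n where "m \<in> {1..}" "n \<in> {1..}" "x = \<rho> m" "y = \<rho> n"
      by blast
    then show "x \<le> y \<or> y \<le> x"
      using assms(2) by (meson mono_onD nle_le)
  qed
qed (use assms in \<open>auto simp: finite_borel_measures_def\<close>)

end

theory Submission
  imports Defs
begin

text \<open>It suffices to find one function \<open>h\<close> with values in \<open>[0, 1]\<close>, positive \<open>\<mu>\<close>-almost everywhere, such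
that \<open>h\<mu> \<in> K\<close>: then \<open>\<nu>\<^sub>n = min(h, 1/n) \<mu> \<le> h\<mu>\<close> lies in \<open>K\<close> because \<open>K\<close> is closed under passing to
smaller measures, and \<open>n \<nu>\<^sub>n = min(n h, 1) \<mu>\<close> increases to \<open>\<mu>\<close>.

Membership in \<open>K\<close> is tested by duality. Write \<open>p(g) = sup {\<integral>g d\<tau> | \<tau> \<in> K}\<close> for continuous \<open>g \<ge> 0\<close>.
A measure \<open>\<tau>\<close> belongs to \<open>K\<close> as soon as \<open>\<integral>g d\<tau> \<le> p(g)\<close> for all such \<open>g\<close>
(\<open>mem_if_test_bounds\<close>). A weak neighbourhood constrains finitely many integrals only, so this follows
from the separation of a point from a convex set in finite dimension; the separating
function may be replaced by its positive part because \<open>K\<close> contains the restriction of each of its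
measures to any Borel set.

Densities \<open>r\<close> with \<open>r\<mu> \<in> K\<close> come from minimising
\<open>p(F) + c \<integral>(1 - F)\<^sup>2 d\<mu>\<close>
over the continuous functions \<open>F\<close> with values in \<open>[0, 1]\<close>, for a given \<open>c > 0\<close>. By uniform convexity
in \<open>L\<^sup>2(\<mu>)\<close> a fast minimising sequence converges \<open>\<mu>\<close>-almost everywhere to some \<open>f\<close>, and stationarity in
the direction of \<open>g \<ge> 0\<close> says precisely that \<open>\<integral>2c (1 - f) g d\<mu> \<le> p(g)\<close>. Hence
\<open>2c (1 - f) \<mu> \<in> K\<close> (\<open>test_bounded_density\<close>).

It remains to see that these densities do not all vanish on a set of positive measure. Comparison
with \<open>F = 0\<close> gives \<open>p(F) \<le> c \<mu>(X) + c\<close> for near-minimisers \<open>F\<close>. Take \<open>c = 2\<^sup>-\<^sup>k / 2\<close> and a near-minimiser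
\<open>F\<^sub>k\<close> that is \<open>2\<^sup>-\<^sup>k\<close>-close in \<open>L\<^sup>1(\<mu>)\<close> to the corresponding limit \<open>f\<^sub>k\<close>. Then \<open>\<Sum>p(F\<^sub>k)\<close> converges, so the set where
\<open>\<Sum>F\<^sub>k\<close> diverges is null for every measure in \<open>K\<close>, and therefore also for \<open>\<mu>\<close>. Consequently \<open>f\<^sub>k \<rightarrow> 0\<close>
almost everywhere for \<open>\<mu>\<close>, and \<open>h = \<Sum>2\<^sup>-\<^sup>k\<^sup>-\<^sup>1 2\<^sup>-\<^sup>k (1 - f\<^sub>k)\<close> is positive almost everywhere; \<open>h\<mu> \<in> K\<close>
because the inequalities \<open>\<integral>g d\<tau> \<le> p(g)\<close> are preserved by infinite convex combinations.\<close>

section \<open>Integration against finite Borel measures\<close>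

lemma fbmD:
  assumes "\<mu> \<in> finite_borel_measures X"
  shows "finite_measure \<mu>" "sets \<mu> = sets (restrict_space borel X)" "space \<mu> = X"
proof -
  show "finite_measure \<mu>" and s: "sets \<mu> = sets (restrict_space borel X)"
    using assms by (auto simp: finite_borel_measures_def)
  show "space \<mu> = X"
    using sets_eq_imp_space_eq[OF s] by (simp add: space_restrict_space)
qed

lemma continuous_on_imp_measurable_fbm:
  fixes f :: "'a::topological_space \<Rightarrow> real"
  assumes "\<mu> \<in> finite_borel_measures X" "continuous_on X f"
  shows "f \<in> borel_measurable \<mu>"
  using borel_measurable_continuous_on_restrict[OF assms(2)]
    measurable_cong_sets[OF fbmD(2)[OF assms(1)] refl] by blast

lemma continuous_on_imp_integrable_fbm:
  fixes f :: "'a::topological_space \<Rightarrow> real"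
  assumes "\<mu> \<in> finite_borel_measures X" "continuous_on X f" "compact X"
  shows "integrable \<mu> f"
proof -
  interpret finite_measure \<mu> using fbmD(1)[OF assms(1)] .
  have "bounded (f ` X)"
    using assms(2,3) compact_continuous_image compact_imp_bounded by blast
  then obtain B where "\<And>x. x \<in> X \<Longrightarrow> norm (f x) \<le> B"
    unfolding bounded_iff by blast
  then show ?thesis
    by (intro integrable_const_bound[of _ B] AE_I2 continuous_on_imp_measurable_fbm[OF assms(1,2)])
       (simp add: fbmD(3)[OF assms(1)])
qed

text \<open>The convexity of a set of measures is stated setwise; this lemma and the next turn it into the
  convexity of the set of its vectors of integrals.\<close>

lemma nn_integral_add_measure:
  assumes s: "sets \<nu> = sets \<mu>" and f: "f \<in> borel_measurable \<mu>"
  shows "nn_integral (add_measure \<mu> \<nu>) f = nn_integral \<mu> f + nn_integral \<nu> f"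
  using f
proof induction
  case (cong f g)
  have sp: "space (add_measure \<mu> \<nu>) = space \<mu>" "space \<nu> = space \<mu>"
    using sets_eq_imp_space_eq[OF s] sets_eq_imp_space_eq[OF sets_add_measure[of \<mu> \<nu>]] by simp_all
  show ?case
    using cong(3,4) sp nn_integral_cong[of "add_measure \<mu> \<nu>" f g] nn_integral_cong[of \<nu> f g]
      nn_integral_cong[of \<mu> f g] by simp
next
  case (set A)
  then show ?case
    using s by (simp add: emeasure_add_measure[OF s])
next
  case (mult f c)
  have "f \<in> borel_measurable \<nu>" "f \<in> borel_measurable (add_measure \<mu> \<nu>)"
    using mult(2) s by (simp_all cong: measurable_cong_sets)
  then show ?case
    using mult by (simp add: nn_integral_cmult distrib_left)
next
  case (add f g)
  have "f \<in> borel_measurable \<nu>" "f \<in> borel_measurable (add_measure \<mu> \<nu>)"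
       "g \<in> borel_measurable \<nu>" "g \<in> borel_measurable (add_measure \<mu> \<nu>)"
    using add s by (simp_all cong: measurable_cong_sets)
  then show ?case
    using add by (simp add: nn_integral_add ac_simps)
next
  case (seq U)
  have m: "\<And>i. U i \<in> borel_measurable \<nu>" "\<And>i. U i \<in> borel_measurable (add_measure \<mu> \<nu>)"
    using seq(1) s by (simp_all cong: measurable_cong_sets)
  have i: "incseq (\<lambda>i. nn_integral M (U i))" for M :: "'a measure"
    using seq(3) by (auto simp: incseq_def le_fun_def intro!: nn_integral_mono)
  have "nn_integral (add_measure \<mu> \<nu>) (\<lambda>x. SUP i. U i x)
      = (SUP i. nn_integral \<mu> (U i) + nn_integral \<nu> (U i))"
    using seq m by (simp add: nn_integral_monotone_convergence_SUP)
  also have "\<dots> = (SUP i. nn_integral \<mu> (U i)) + (SUP i. nn_integral \<nu> (U i))"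
    by (intro ennreal_SUP_add i)
  also have "\<dots> = nn_integral \<mu> (\<lambda>x. SUP i. U i x) + nn_integral \<nu> (\<lambda>x. SUP i. U i x)"
    using seq m by (simp add: nn_integral_monotone_convergence_SUP)
  finally show ?case
    by (simp add: image_comp)
qed

lemma integral_combination_measure:
  fixes f :: "'a \<Rightarrow> real"
  assumes s: "sets \<nu> = sets \<mu>" and i: "integrable \<mu> f" "integrable \<nu> f" and "u \<ge> 0" "v \<ge> 0"
  shows "(LINT x|add_measure (scale_measure (ennreal u) \<mu>) (scale_measure (ennreal v) \<nu>). f x)
    = u * (LINT x|\<mu>. f x) + v * (LINT x|\<nu>. f x)"
proof -
  let ?S = "add_measure (scale_measure (ennreal u) \<mu>) (scale_measure (ennreal v) \<nu>)"
  have fm: "f \<in> borel_measurable \<mu>" "f \<in> borel_measurable \<nu>"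
    using i by (simp_all add: borel_measurable_integrable)
  have nn: "nn_integral ?S g = ennreal u * nn_integral \<mu> g + ennreal v * nn_integral \<nu> g"
    if "g \<in> borel_measurable \<mu>" for g :: "'a \<Rightarrow> ennreal"
  proof -
    have "g \<in> borel_measurable \<nu>" using that s by (simp cong: measurable_cong_sets)
    then show ?thesis
      using s that
      by (subst nn_integral_add_measure) (simp_all add: nn_integral_scale_measure)
  qed
  have bd: "nn_integral \<mu> g < \<infinity>" "nn_integral \<nu> g < \<infinity>"
    if g: "\<And>x. g x \<le> ennreal (norm (f x))" for g
  proof -
    have "nn_integral M g \<le> (\<integral>\<^sup>+x. ennreal (norm (f x)) \<partial>M)" for M
      by (intro nn_integral_mono g)
    then show "nn_integral \<mu> g < \<infinity>" "nn_integral \<nu> g < \<infinity>"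
      using i unfolding integrable_iff_bounded by (metis le_less_trans)+
  qed
  have *: "enn2real (nn_integral ?S g) = u * enn2real (nn_integral \<mu> g) + v * enn2real (nn_integral \<nu> g)"
    if "\<And>x. g x \<le> ennreal (norm (f x))" "g \<in> borel_measurable \<mu>" for g
    using bd[OF that(1)] \<open>u \<ge> 0\<close> \<open>v \<ge> 0\<close>
    by (simp add: nn[OF that(2)] enn2real_plus enn2real_mult ennreal_mult_less_top)
  have "integrable ?S f"
    using fm bd[OF order_refl] nn[of "\<lambda>x. ennreal (norm (f x))"]
    by (auto simp: integrable_iff_bounded ennreal_mult_less_top cong: measurable_cong_sets)
  then show ?thesis
    using fm i
    by (simp add: real_lebesgue_integral_def *[of "\<lambda>x. ennreal (f x)"] *[of "\<lambda>x. ennreal (- f x)"]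
        ennreal_leI algebra_simps)
qed

text \<open>Bounded densities keep a measure finite; this is the only source of new measures below.\<close>

lemma density_in_fbm:
  assumes \<mu>: "\<mu> \<in> finite_borel_measures X" and h: "h \<in> borel_measurable \<mu>"
    and b: "\<And>x. 0 \<le> h x" "\<And>x. h x \<le> (C::real)"
  shows "density \<mu> h \<in> finite_borel_measures X"
proof -
  interpret finite_measure \<mu> using fbmD(1)[OF \<mu>] .
  have "(\<integral>\<^sup>+x. ennreal (h x) \<partial>\<mu>) \<le> (\<integral>\<^sup>+x. ennreal C \<partial>\<mu>)"
    by (intro nn_integral_mono ennreal_leI b)
  also have "\<dots> < \<infinity>"
    by (simp add: ennreal_mult_eq_top_iff less_top[symmetric])
  finally have "emeasure (density \<mu> h) (space \<mu>) < \<infinity>"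
    using h by (subst emeasure_density) (auto simp: mult_indicator_cong cong: nn_integral_cong)
  then have "finite_measure (density \<mu> h)"
    by (intro finite_measureI) auto
  then show ?thesis
    using fbmD(2)[OF \<mu>] by (simp add: finite_borel_measures_def)
qed

section \<open>Weak neighbourhoods\<close>

text \<open>The sets described by finitely many inequalities on integrals form a neighbourhood basis. The
  generating sets allow one functional each, so finite families arise from finite intersections.\<close>

lemma weak_open_contains_basic:
  assumes "openin (weak_measure_topology X) U" "\<tau> \<in> U"
  shows "\<exists>(F :: ('a::topological_space \<Rightarrow> real) set) (\<epsilon> :: real). finite F \<and> (\<forall>f\<in>F. continuous_on X f) \<and> \<epsilon> > 0 \<and>
    {\<sigma> \<in> finite_borel_measures X. \<forall>f\<in>F. \<bar>(LINT x|\<sigma>. f x) - (LINT x|\<tau>. f x)\<bar> < \<epsilon>} \<subseteq> U"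
proof -
  let ?B = "\<lambda>F \<epsilon> \<tau>. {\<sigma> \<in> finite_borel_measures X.
      \<forall>f\<in>F. \<bar>(LINT x|\<sigma>. f x) - (LINT x|\<tau>. f x)\<bar> < (\<epsilon>::real)}"
  have "generate_topology_on
     {{\<mu> \<in> finite_borel_measures X. (LINT x|\<mu>. f x) \<in> U} | (f :: 'a \<Rightarrow> real) U.
        continuous_on X f \<and> open U} U"
    using assms(1) unfolding weak_measure_topology_def by (rule openin_topology_generated_by)
  then show ?thesis
    using assms(2)
  proof (induction arbitrary: \<tau>)
    case Empty
    then show ?case by simp
  next
    case (Int a b)
    from Int.IH(1)[of \<tau>] Int.prems
    obtain F d where F: "finite F" "\<forall>f\<in>F. continuous_on X f" "d > 0" "?B F d \<tau> \<subseteq> a"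
      by blast
    from Int.IH(2)[of \<tau>] Int.prems
    obtain G e where G: "finite G" "\<forall>f\<in>G. continuous_on X f" "e > 0" "?B G e \<tau> \<subseteq> b"
      by blast
    have "?B (F \<union> G) (min d e) \<tau> \<subseteq> ?B F d \<tau>" "?B (F \<union> G) (min d e) \<tau> \<subseteq> ?B G e \<tau>"
      by simp_all blast+
    then have "?B (F \<union> G) (min d e) \<tau> \<subseteq> a \<inter> b"
      using F(4) G(4) by (meson Int_greatest order_trans)
    moreover have "finite (F \<union> G)" "\<forall>f\<in>F \<union> G. continuous_on X f" "min d e > 0"
      using F G by auto
    ultimately show ?case by blast
  next
    case (UN K)
    then obtain k where k: "k \<in> K" "\<tau> \<in> k" by blast
    from UN.IH[OF k]
    obtain F d where F: "finite F" "\<forall>f\<in>F. continuous_on X f" "d > 0" "?B F d \<tau> \<subseteq> k"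
      by blast
    have "?B F d \<tau> \<subseteq> \<Union>K"
      using F(4) k(1) by (rule order_trans[OF _ Union_upper])
    with F(1-3) show ?case by blast
  next
    case (Basis s)
    from Basis.hyps obtain f :: "'a \<Rightarrow> real" and U where s: "s = {\<mu> \<in> finite_borel_measures X. (LINT x|\<mu>. f x) \<in> U}"
      and f: "continuous_on X f" "open U" by blast
    have "(LINT x|\<tau>. f x) \<in> U" using Basis.prems s by simp
    then obtain e where e: "e > 0" "\<And>y. dist y (LINT x|\<tau>. f x) < e \<Longrightarrow> y \<in> U"
      using f(2) unfolding open_dist by blast
    have "?B {f} e \<tau> \<subseteq> s"
      unfolding s using e(2) by (simp add: dist_real_def subset_iff)
    moreover have "finite {f}" "\<forall>f\<in>{f}. continuous_on X f"
      using f(1) by simp_all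
    ultimately show ?case using e(1) by blast
  qed
qed

section \<open>Separation in finite dimension\<close>

text \<open>The passage to the limit \<open>t \<rightarrow> 0\<close> that ends both first-variation arguments below.\<close>

lemma le_if_le_add_vanishing:
  fixes a b C :: real
  assumes "\<And>t. 0 < t \<Longrightarrow> t \<le> 1 \<Longrightarrow> a \<le> b + t * C"
  shows "a \<le> b"
proof (rule tendsto_lowerbound)
  show "((\<lambda>t. b + t * C) \<longlongrightarrow> b) (at_right 0)"
    by (auto intro!: tendsto_eq_intros)
  show "\<forall>\<^sub>F t in at_right 0. a \<le> b + t * C"
    unfolding eventually_at_right_field by (rule exI[of _ 1]) (auto intro: assms)
qed simp

text \<open>The normal vector is \<open>y - z\<close>, where \<open>z\<close> is the nearest point to \<open>y\<close> in the closure of \<open>S\<close>. The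
  index set \<open>I\<close> is a set and not a type because it will be a family of test functions that depends on
  the neighbourhood; therefore the nearest point is constructed by hand, as the coordinatewise limit of
  a minimising sequence, which is Cauchy by the parallelogram law.\<close>

lemma separate_point_from_convex:
  fixes S :: "('i \<Rightarrow> real) set" and y :: "'i \<Rightarrow> real"
  assumes I: "finite I" and ne: "S \<noteq> {}"
    and conv: "\<And>x z t. x \<in> S \<Longrightarrow> z \<in> S \<Longrightarrow> 0 \<le> t \<Longrightarrow> t \<le> 1 \<Longrightarrow> (\<lambda>i. (1 - t) * x i + t * z i) \<in> S"
    and \<epsilon>: "\<epsilon> > 0" and far: "\<And>x. x \<in> S \<Longrightarrow> \<exists>i\<in>I. \<epsilon> \<le> \<bar>x i - y i\<bar>"
  shows "\<exists>w s. (\<forall>x\<in>S. (\<Sum>i\<in>I. w i * x i) \<le> s) \<and> s < (\<Sum>i\<in>I. w i * y i)"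
proof -
  define q where "q x = (\<Sum>i\<in>I. (x i - y i)\<^sup>2)" for x
  have ge: "\<epsilon>\<^sup>2 \<le> q x" if x: "x \<in> S" for x
  proof -
    obtain i where i: "i \<in> I" "\<epsilon> \<le> \<bar>x i - y i\<bar>" using far[OF x] by blast
    have "\<epsilon>\<^sup>2 \<le> (x i - y i)\<^sup>2"
      using power_mono[OF i(2), of 2] \<epsilon> by simp
    also have "\<dots> \<le> q x"
      unfolding q_def using I i(1) by (intro member_le_sum) auto
    finally show ?thesis .
  qed
  define m where "m = Inf (q ` S)"
  have bdd: "bdd_below (q ` S)"
    using ge by (intro bdd_belowI2)
  have m_le: "m \<le> q x" if "x \<in> S" for x
    unfolding m_def using bdd that by (auto intro: cInf_lower)
  have "\<epsilon>\<^sup>2 \<le> m"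
    unfolding m_def using ne ge by (auto intro: cInf_greatest)
  then have m_pos: "0 < m" using \<epsilon> by (meson less_le_trans zero_less_power)
  have "\<exists>x\<in>S. q x < m + inverse (real (Suc n))" for n
    using cInf_less_iff[of "q ` S" "m + inverse (real (Suc n))"] ne bdd by (auto simp: m_def)
  then obtain x where x: "\<And>n. x n \<in> S" "\<And>n. q (x n) < m + inverse (real (Suc n))"
    by metis
  have close: "(x n i - x k i)\<^sup>2 \<le> 2 * inverse (real (Suc n)) + 2 * inverse (real (Suc k))" if "i \<in> I" for n k i
  proof -
    \<comment> \<open>The midpoint is a competitor, so two near-minimisers cannot be far apart.\<close>
    have "m \<le> q (\<lambda>i. (1 - 1/2) * x n i + 1/2 * x k i)"
      by (intro m_le conv x) auto
    also have "\<dots> = q (x n) / 2 + q (x k) / 2 - (\<Sum>i\<in>I. (x n i - x k i)\<^sup>2) / 4"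
      unfolding q_def sum_divide_distrib sum.distrib[symmetric] sum_subtractf[symmetric]
      by (intro sum.cong refl) (simp add: power2_eq_square field_simps)
    finally have "(\<Sum>i\<in>I. (x n i - x k i)\<^sup>2) \<le> 2 * inverse (real (Suc n)) + 2 * inverse (real (Suc k))"
      using x(2)[of n] x(2)[of k] by linarith
    moreover have "(x n i - x k i)\<^sup>2 \<le> (\<Sum>i\<in>I. (x n i - x k i)\<^sup>2)"
      using I that by (intro member_le_sum) auto
    ultimately show ?thesis by linarith
  qed
  have conv_x: "convergent (\<lambda>n. x n i)" if "i \<in> I" for i
  proof (rule Cauchy_convergent, rule metric_CauchyI)
    fix e :: real assume e: "e > 0"
    then have "0 < e\<^sup>2 / 4" by simp
    then obtain N where N: "inverse (real (Suc N)) < e\<^sup>2 / 4"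
      using reals_Archimedean by blast
    show "\<exists>M. \<forall>n\<ge>M. \<forall>k\<ge>M. dist (x n i) (x k i) < e"
    proof (intro exI allI impI)
      fix n k assume nk: "N \<le> n" "N \<le> k"
      have "inverse (real (Suc n)) \<le> inverse (real (Suc N))"
        "inverse (real (Suc k)) \<le> inverse (real (Suc N))"
        using nk by (auto intro!: le_imp_inverse_le)
      then have "(x n i - x k i)\<^sup>2 < e\<^sup>2"
        using close[OF that, of n k] N by linarith
      then show "dist (x n i) (x k i) < e"
        unfolding dist_real_def using e abs_le_square_iff[of e "x n i - x k i"] by simp
    qed
  qed
  define z where "z i = lim (\<lambda>n. x n i)" for i
  have z: "(\<lambda>n. x n i) \<longlonglongrightarrow> z i" if "i \<in> I" for i
    unfolding z_def using conv_x[OF that] by (simp only: convergent_LIMSEQ_iff)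
  have mlim: "(\<lambda>n. m + inverse (real (Suc n))) \<longlonglongrightarrow> m"
    using tendsto_add[OF tendsto_const[of m] LIMSEQ_inverse_real_of_nat] by simp
  have "(\<lambda>n. q (x n)) \<longlonglongrightarrow> q z"
    unfolding q_def by (intro tendsto_intros z)
  moreover have "(\<lambda>n. q (x n)) \<longlonglongrightarrow> m"
    by (rule tendsto_sandwich[OF _ _ tendsto_const mlim]; rule eventuallyI)
       (rule m_le[OF x(1)], rule less_imp_le[OF x(2)])
  ultimately have qz: "q z = m" by (rule LIMSEQ_unique)
  \<comment> \<open>First variation at \<open>z\<close> in the direction of \<open>v\<close>: the angle at \<open>z\<close> is at least a right angle.\<close>
  have var: "0 \<le> (\<Sum>i\<in>I. (z i - y i) * (v i - z i))" if v: "v \<in> S" for v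
  proof -
    have "0 \<le> 2 * (\<Sum>i\<in>I. (z i - y i) * (v i - z i)) + t * (\<Sum>i\<in>I. (v i - z i)\<^sup>2)"
      if t: "0 < t" "t \<le> 1" for t
    proof -
      have "(\<lambda>n. q (\<lambda>i. (1 - t) * x n i + t * v i)) \<longlonglongrightarrow> q (\<lambda>i. (1 - t) * z i + t * v i)"
        unfolding q_def by (intro tendsto_intros z)
      then have "m \<le> q (\<lambda>i. (1 - t) * z i + t * v i)"
        by (rule tendsto_lowerbound) (use t v in \<open>auto intro!: eventuallyI m_le conv x\<close>)
      also have "\<dots> = q z + t * (2 * (\<Sum>i\<in>I. (z i - y i) * (v i - z i)) + t * (\<Sum>i\<in>I. (v i - z i)\<^sup>2))"
        unfolding q_def sum_distrib_left sum.distrib[symmetric]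
        by (intro sum.cong refl) (simp add: power2_eq_square algebra_simps)
      finally have "0 \<le> t * (2 * (\<Sum>i\<in>I. (z i - y i) * (v i - z i)) + t * (\<Sum>i\<in>I. (v i - z i)\<^sup>2))"
        using qz by simp
      then show ?thesis using t by (simp add: zero_le_mult_iff)
    qed
    then have "0 \<le> 2 * (\<Sum>i\<in>I. (z i - y i) * (v i - z i))"
      by (rule le_if_le_add_vanishing)
    then show ?thesis by simp
  qed
  show ?thesis
  proof (intro exI conjI ballI)
    fix v assume v: "v \<in> S"
    have "(\<Sum>i\<in>I. (y i - z i) * v i) = (\<Sum>i\<in>I. (y i - z i) * z i) - (\<Sum>i\<in>I. (z i - y i) * (v i - z i))"
      unfolding sum_subtractf[symmetric] by (intro sum.cong refl) (simp add: algebra_simps)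
    then show "(\<Sum>i\<in>I. (y i - z i) * v i) \<le> (\<Sum>i\<in>I. (y i - z i) * z i)"
      using var[OF v] by simp
  next
    have "(\<Sum>i\<in>I. (y i - z i) * y i) = (\<Sum>i\<in>I. (y i - z i) * z i) + q z"
      unfolding q_def sum.distrib[symmetric]
      by (intro sum.cong refl) (simp add: power2_eq_square algebra_simps)
    then show "(\<Sum>i\<in>I. (y i - z i) * z i) < (\<Sum>i\<in>I. (y i - z i) * y i)"
      using qz m_pos by simp
  qed
qed

section \<open>The dual description of a weakly closed convex set of measures\<close>

text \<open>\<open>test_bound X K g s\<close> says \<open>p(g) \<le> s\<close> for the support function \<open>p(g) = sup {\<integral>g d\<tau> | \<tau> \<in> K}\<close> of
  \<open>K\<close> on nonnegative continuous functions. Working with the epigraph of \<open>p\<close> avoids its infinite values;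
  the closure properties below are the sublinearity and monotonicity of \<open>p\<close>.\<close>

definition test_bound :: "'a::topological_space set \<Rightarrow> 'a measure set \<Rightarrow> ('a \<Rightarrow> real) \<Rightarrow> real \<Rightarrow> bool" where
  "test_bound X K g s \<longleftrightarrow>
     continuous_on X g \<and> (\<forall>x\<in>X. 0 \<le> g x) \<and> (\<forall>\<tau>\<in>K. (LINT x|\<tau>. g x) \<le> s)"

lemma test_bound_combination:
  assumes X: "compact X" and K: "K \<subseteq> finite_borel_measures X"
    and f: "test_bound X K f a" and g: "test_bound X K g b" and uv: "0 \<le> u" "0 \<le> v"
  shows "test_bound X K (\<lambda>x. u * f x + v * g x) (u * a + v * b)"
proof -
  have c: "continuous_on X f" "continuous_on X g"
    using f g by (auto simp: test_bound_def)
  have "(LINT x|\<tau>. u * f x + v * g x) \<le> u * a + v * b" if \<tau>: "\<tau> \<in> K" for \<tau>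
  proof -
    have "integrable \<tau> f" "integrable \<tau> g"
      using continuous_on_imp_integrable_fbm[OF _ _ X] c K \<tau> by auto
    then have "(LINT x|\<tau>. u * f x + v * g x) = u * (LINT x|\<tau>. f x) + v * (LINT x|\<tau>. g x)"
      by simp
    also have "\<dots> \<le> u * a + v * b"
      using f g \<tau> uv by (intro add_mono mult_left_mono) (auto simp: test_bound_def)
    finally show ?thesis .
  qed
  then show ?thesis
    using f g uv by (auto simp: test_bound_def intro!: continuous_intros)
qed

lemma test_bound_min_1:
  assumes X: "compact X" and K: "K \<subseteq> finite_borel_measures X" and f: "test_bound X K f s"
  shows "test_bound X K (\<lambda>x. min 1 (f x)) s"
proof -
  have c: "continuous_on X f" "continuous_on X (\<lambda>x. min 1 (f x))"
    using f by (auto simp: test_bound_def intro!: continuous_intros)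
  have "(LINT x|\<tau>. min 1 (f x)) \<le> s" if \<tau>: "\<tau> \<in> K" for \<tau>
  proof -
    have "(LINT x|\<tau>. min 1 (f x)) \<le> (LINT x|\<tau>. f x)"
      using continuous_on_imp_integrable_fbm[OF _ _ X] c K \<tau> by (intro integral_mono) auto
    also have "\<dots> \<le> s" using f \<tau> by (auto simp: test_bound_def)
    finally show ?thesis .
  qed
  then show ?thesis
    using f c by (auto simp: test_bound_def)
qed

lemma test_bound_nonneg:
  assumes K: "K \<subseteq> finite_borel_measures X" "K \<noteq> {}" and f: "test_bound X K f s"
  shows "0 \<le> s"
proof -
  obtain \<tau> where \<tau>: "\<tau> \<in> K" using K by blast
  have "0 \<le> (LINT x|\<tau>. f x)"
    using f \<tau> K fbmD(3)[of \<tau> X] by (intro Bochner_Integration.integral_nonneg) (auto simp: test_bound_def)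
  also have "\<dots> \<le> s" using f \<tau> by (auto simp: test_bound_def)
  finally show ?thesis .
qed

lemma density_mono_fbm:
  assumes \<mu>: "\<mu> \<in> finite_borel_measures X"
    and m: "g \<in> borel_measurable \<mu>" "h \<in> borel_measurable \<mu>"
    and b: "\<And>x. 0 \<le> g x" "\<And>x. g x \<le> h x" "\<And>x. h x \<le> (C::real)"
  shows "density \<mu> g \<le> density \<mu> h"
proof -
  have "density \<mu> g \<in> finite_borel_measures X" "density \<mu> h \<in> finite_borel_measures X"
    by (rule density_in_fbm[OF \<mu> _ _, of _ C]; use m b order_trans in blast)+
  then show ?thesis
    using m b fbmD(2)[OF \<mu>]
    by (subst le_finite_borel_measures_iff)
       (auto simp: emeasure_density intro!: nn_integral_mono mult_right_mono ennreal_leI)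
qed

text \<open>The first form serves to describe an exceptional set that is visibly measurable, the second
  gives usable convergence.\<close>

lemma AE_summable_if_integrals_summable:
  fixes f :: "nat \<Rightarrow> 'a \<Rightarrow> real"
  assumes f: "\<And>n. integrable M (f n)" "\<And>n x. x \<in> space M \<Longrightarrow> 0 \<le> f n x"
    and b: "\<And>n. (LINT x|M. f n x) \<le> b n" "summable b"
  shows "AE x in M. (\<Sum>n. ennreal (f n x)) \<noteq> \<infinity>"
    and "AE x in M. summable (\<lambda>n. f n x)"
proof -
  have b0: "0 \<le> b n" for n
    using order_trans[OF Bochner_Integration.integral_nonneg[OF f(2)] b(1)[of n]] .
  have [measurable]: "f n \<in> borel_measurable M" for n
    using f(1) by (rule borel_measurable_integrable)
  have "(\<integral>\<^sup>+x. (\<Sum>n. ennreal (f n x)) \<partial>M) = (\<Sum>n. \<integral>\<^sup>+x. ennreal (f n x) \<partial>M)"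
    by (rule nn_integral_suminf) measurable
  also have "\<dots> = (\<Sum>n. ennreal (LINT x|M. f n x))"
    by (intro suminf_cong nn_integral_eq_integral f AE_I2)
  also have "\<dots> \<le> (\<Sum>n. ennreal (b n))"
    by (intro suminf_le ennreal_leI b) auto
  also have "\<dots> = ennreal (\<Sum>n. b n)"
    by (rule suminf_ennreal2[OF b0 b(2)])
  finally have "(\<integral>\<^sup>+x. (\<Sum>n. ennreal (f n x)) \<partial>M) \<noteq> \<infinity>"
    by (auto simp: top_unique)
  then show *: "AE x in M. (\<Sum>n. ennreal (f n x)) \<noteq> \<infinity>"
    by (intro nn_integral_PInf_AE) measurable
  show "AE x in M. summable (\<lambda>n. f n x)"
    using * by (rule AE_mp) (auto intro!: AE_I2 summable_suminf_not_top f(2))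
qed

text \<open>If \<open>\<tau>0\<close> were not in \<open>K\<close>, a basic neighbourhood of \<open>\<tau>0\<close> would miss \<open>K\<close>, so the vectors of the
  integrals of finitely many functions separate \<open>\<tau>0\<close> from \<open>K\<close>. The separating vector defines a
  continuous \<open>g\<close> with \<open>\<integral>g d\<tau> \<le> s < \<integral>g d\<tau>0\<close> for \<open>\<tau> \<in> K\<close>. Applying this bound to the restriction of
  \<open>\<tau>\<close> to \<open>{g > 0}\<close>, which is again in \<open>K\<close>, gives \<open>\<integral>max 0 g d\<tau> \<le> s\<close>; so the nonnegative function
  \<open>max 0 g\<close> violates the hypothesis.\<close>

lemma mem_if_test_bounds:
  assumes X: "compact X" and K: "K \<subseteq> finite_borel_measures X" "K \<noteq> {}"
    and conv: "convex_measures (K :: 'a::topological_space measure set)" and closed: "closedin (weak_measure_topology X) K"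
    and hered: "\<And>\<nu> \<tau>. \<nu> \<in> K \<Longrightarrow> \<tau> \<in> finite_borel_measures X \<Longrightarrow> \<tau> \<le> \<nu> \<Longrightarrow> \<tau> \<in> K"
    and \<tau>0: "\<tau>0 \<in> finite_borel_measures X"
    and bound: "\<And>g s. test_bound X K g s \<Longrightarrow> (LINT x|\<tau>0. g x) \<le> s"
  shows "\<tau>0 \<in> K"
proof (rule ccontr)
  assume notin: "\<tau>0 \<notin> K"
  have "openin (weak_measure_topology X) (finite_borel_measures X - K)"
    using closed by (simp add: closedin_def topspace_weak_measure_topology)
  from weak_open_contains_basic[OF this, of \<tau>0] \<tau>0 notin
  obtain F :: "('a \<Rightarrow> real) set" and \<epsilon> :: real where F: "finite F" "\<And>f. f \<in> F \<Longrightarrow> continuous_on X f" and \<epsilon>: "\<epsilon> > 0"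
    and sub: "{\<sigma> \<in> finite_borel_measures X. \<forall>f\<in>F. \<bar>(LINT x|\<sigma>. f x) - (LINT x|\<tau>0. f x)\<bar> < \<epsilon>}
      \<subseteq> finite_borel_measures X - K"
    by auto
  \<comment> \<open>The value \<open>0\<close> outside \<open>F\<close> makes the vectors of integrals a convex set: functions that are not
    integrable would destroy linearity.\<close>
  define ev where "ev \<tau> f = (if f \<in> F then LINT x|\<tau>. f x else 0)" for \<tau> f
  have int: "integrable \<tau> f" if "\<tau> \<in> finite_borel_measures X" "f \<in> F" for \<tau> and f :: "'a \<Rightarrow> real"
    using continuous_on_imp_integrable_fbm[OF that(1) F(2)[OF that(2)] X] .
  have "\<exists>w s. (\<forall>x\<in>ev ` K. (\<Sum>f\<in>F. w f * x f) \<le> s) \<and> s < (\<Sum>f\<in>F. w f * ev \<tau>0 f)"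
  proof (rule separate_point_from_convex[OF F(1) _ _ \<epsilon>])
    fix x z and t :: real
    assume "x \<in> ev ` K" "z \<in> ev ` K" and t: "0 \<le> t" "t \<le> 1"
    then obtain \<sigma> \<tau> where st: "\<sigma> \<in> K" "x = ev \<sigma>" "\<tau> \<in> K" "z = ev \<tau>" by blast
    let ?\<rho> = "add_measure (scale_measure (ennreal (1 - t)) \<sigma>) (scale_measure (ennreal t) \<tau>)"
    have s: "sets \<tau> = sets \<sigma>"
      using st K(1) fbmD(2)[of _ X] by (metis subsetD)
    have "?\<rho> \<in> K"
      using conv st t unfolding convex_measures_def by auto
    moreover have "ev ?\<rho> = (\<lambda>i. (1 - t) * x i + t * z i)"
      using st t K(1) by (auto simp: ev_def fun_eq_iff intro!: integral_combination_measure[OF s] int)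
    ultimately show "(\<lambda>i. (1 - t) * x i + t * z i) \<in> ev ` K"
      by (metis image_eqI)
  next
    fix x assume "x \<in> ev ` K"
    then obtain \<sigma> where \<sigma>: "\<sigma> \<in> K" "x = ev \<sigma>" by blast
    then have "\<not> (\<forall>f\<in>F. \<bar>(LINT x|\<sigma>. f x) - (LINT x|\<tau>0. f x)\<bar> < \<epsilon>)"
      using sub K(1) by blast
    then show "\<exists>f\<in>F. \<epsilon> \<le> \<bar>x f - ev \<tau>0 f\<bar>"
      by (auto simp: \<sigma> ev_def not_less)
  qed (use K in auto)
  then obtain w s where le: "\<And>\<tau>. \<tau> \<in> K \<Longrightarrow> (\<Sum>f\<in>F. w f * ev \<tau> f) \<le> s"
    and gt: "s < (\<Sum>f\<in>F. w f * ev \<tau>0 f)"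
    by blast
  define g where "g x = (\<Sum>f\<in>F. w f * f x)" for x
  have gc: "continuous_on X g"
    unfolding g_def by (intro continuous_intros F(2))
  have gpc: "continuous_on X (\<lambda>x. max 0 (g x))"
    by (intro continuous_intros gc)
  have gint: "(LINT x|\<tau>. g x) = (\<Sum>f\<in>F. w f * ev \<tau> f)" if "\<tau> \<in> finite_borel_measures X" for \<tau>
    unfolding g_def using int[OF that]
    by (subst Bochner_Integration.integral_sum) (auto simp: ev_def)
  have "test_bound X K (\<lambda>x. max 0 (g x)) s"
    unfolding test_bound_def
  proof (intro conjI ballI gpc)
    fix \<tau> assume \<tau>: "\<tau> \<in> K"
    then have \<tau>': "\<tau> \<in> finite_borel_measures X" using K by blast
    have gm[measurable]: "g \<in> borel_measurable \<tau>"
      using continuous_on_imp_measurable_fbm[OF \<tau>' gc] .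
    \<comment> \<open>The density of the restriction of \<open>\<tau>\<close> to \<open>{g > 0}\<close>.\<close>
    define h where "h x = (if g x > 0 then 1 else 0 :: real)" for x
    have hm[measurable]: "h \<in> borel_measurable \<tau>"
      unfolding h_def by measurable
    have d: "density \<tau> h \<in> finite_borel_measures X"
      by (rule density_in_fbm[OF \<tau>' hm, of 1]) (auto simp: h_def)
    have "density \<tau> h \<le> density \<tau> (\<lambda>_. 1 :: real)"
      by (rule density_mono_fbm[OF \<tau>' hm, of _ 1]) (auto simp: h_def)
    then have "density \<tau> h \<in> K"
      using hered[OF \<tau> d] by (simp add: density_1)
    then have "(LINT x|density \<tau> h. g x) \<le> s"
      using le gint[OF d] by simp
    moreover have "(LINT x|density \<tau> h. g x) = (LINT x|\<tau>. h x * g x)"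
      by (subst integral_density) (auto simp: h_def)
    moreover have "(\<lambda>x. h x * g x) = (\<lambda>x. max 0 (g x))"
      by (auto simp: h_def fun_eq_iff)
    ultimately show "(LINT x|\<tau>. max 0 (g x)) \<le> s" by simp
  qed simp
  then have "(LINT x|\<tau>0. max 0 (g x)) \<le> s" by (rule bound)
  moreover have "(LINT x|\<tau>0. g x) \<le> (LINT x|\<tau>0. max 0 (g x))"
    by (intro integral_mono continuous_on_imp_integrable_fbm[OF \<tau>0 _ X] gc gpc) auto
  ultimately show False
    using gt gint[OF \<tau>0] by simp
qed

section \<open>Densities from a quadratic minimisation problem\<close>

text \<open>A weighted arithmetic-geometric mean inequality that turns \<open>L\<^sup>2\<close> bounds into \<open>L\<^sup>1\<close> bounds on a
  finite measure space.\<close>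

lemma abs_le_scaled_square:
  fixes a d :: real
  assumes "a > 0"
  shows "\<bar>d\<bar> \<le> a * d\<^sup>2 + 1 / a"
proof (cases "\<bar>d\<bar> \<le> 1 / a")
  case True
  moreover have "0 \<le> a * d\<^sup>2" using assms by simp
  ultimately show ?thesis by linarith
next
  case False
  then have "1 * \<bar>d\<bar> \<le> (a * \<bar>d\<bar>) * \<bar>d\<bar>"
    using assms by (intro mult_right_mono) (simp_all add: field_simps)
  also have "\<dots> = a * d\<^sup>2" by (simp add: power2_eq_square)
  finally show ?thesis using assms by (simp add: add_increasing2)
qed

text \<open>With weight \<open>2\<^sup>n\<close> in \<open>abs_le_scaled_square\<close>, the rate \<open>8\<^sup>-\<^sup>n\<close> for the squares becomes \<open>2\<^sup>-\<^sup>n\<close> for the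
  \<open>L\<^sup>1\<close> norms of the increments, so the telescoping series converges absolutely almost everywhere.\<close>

lemma AE_convergent_if_fast_L2_Cauchy:
  fixes F :: "nat \<Rightarrow> 'a \<Rightarrow> real"
  assumes M: "finite_measure M"
    and F: "\<And>n. integrable M (F n)"
    and sq: "\<And>n. integrable M (\<lambda>x. (F n x - F (Suc n) x)\<^sup>2)"
      "\<And>n. (LINT x|M. (F n x - F (Suc n) x)\<^sup>2) \<le> C * (1/8) ^ n"
  shows "AE x in M. convergent (\<lambda>n. F n x)"
proof -
  interpret finite_measure M by fact
  have "(LINT x|M. \<bar>F n x - F (Suc n) x\<bar>) \<le> (C + measure M (space M)) * (1/2) ^ n" for n
  proof -
    have "(LINT x|M. \<bar>F n x - F (Suc n) x\<bar>)
        \<le> (LINT x|M. 2 ^ n * (F n x - F (Suc n) x)\<^sup>2 + 1 / 2 ^ n)"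
      by (intro integral_mono Bochner_Integration.integrable_add integrable_mult_right sq integrable_const
          integrable_abs Bochner_Integration.integrable_diff F abs_le_scaled_square) auto
    also have "\<dots> = 2 ^ n * (LINT x|M. (F n x - F (Suc n) x)\<^sup>2) + measure M (space M) * (1/2) ^ n"
      using sq(1) by (simp add: power_one_over field_simps)
    also have "\<dots> \<le> 2 ^ n * (C * (1/8) ^ n) + measure M (space M) * (1/2) ^ n"
      by (intro add_mono mult_left_mono sq) auto
    also have "2 ^ n * (C * (1/8) ^ n) = C * (1/4 :: real) ^ n"
      by (simp add: power_mult_distrib[symmetric])
    also have "C * (1/4 :: real) ^ n \<le> C * (1/2) ^ n"
    proof (intro mult_left_mono power_mono)
      have "0 \<le> (LINT x|M. (F 0 x - F (Suc 0) x)\<^sup>2)" by (rule Bochner_Integration.integral_nonneg) simp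
      also have "\<dots> \<le> C * (1/8) ^ 0" by (rule sq(2))
      finally show "0 \<le> C" by simp
    qed auto
    finally show ?thesis by (simp add: algebra_simps)
  qed
  then have "AE x in M. summable (\<lambda>n. \<bar>F n x - F (Suc n) x\<bar>)"
    by (intro AE_summable_if_integrals_summable(2)[where b = "\<lambda>n. (C + measure M (space M)) * (1/2) ^ n"]
        integrable_abs Bochner_Integration.integrable_diff F summable_mult summable_geometric) auto
  then show ?thesis
  proof (rule AE_mp, intro AE_I2 impI)
    fix x assume "summable (\<lambda>n. \<bar>F n x - F (Suc n) x\<bar>)"
    then have "summable (\<lambda>n. F n x - F (Suc n) x)" by (rule summable_rabs_cancel)
    then have "convergent (\<lambda>n. \<Sum>k<n. F k x - F (Suc k) x)"
      by (simp add: summable_iff_convergent)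
    then have "convergent (\<lambda>n. F 0 x - F n x)"
      by (simp only: sum_lessThan_telescope'[of "\<lambda>k. F k x"])
    from convergent_diff[OF convergent_const[of "F 0 x"] this]
    show "convergent (\<lambda>n. F n x)" by simp
  qed
qed

text \<open>The function \<open>f\<close> is the almost everywhere limit of a sequence minimising \<open>s + c \<integral>(1 - F)\<^sup>2 d\<mu>\<close>
  over the pairs with \<open>F \<le> 1\<close> and \<open>test_bound X K F s\<close>. The bound on \<open>\<integral>2c (1 - f) g d\<mu>\<close> is the first-order
  condition at the minimum; the last property records that \<open>f\<close> is an \<open>L\<^sup>1\<close> limit of continuous functions
  whose integrals against all measures in \<open>K\<close> are of order \<open>c\<close>.\<close>

lemma test_bounded_density:
  fixes c :: real
  assumes X: "compact X" and K: "K \<subseteq> finite_borel_measures X" "K \<noteq> {}"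
    and \<mu>: "\<mu> \<in> finite_borel_measures X" and c: "c > 0"
  obtains f where "f \<in> borel_measurable \<mu>" "\<And>x. 0 \<le> f x" "\<And>x. f x \<le> 1"
    and "\<And>g s. test_bound X K g s \<Longrightarrow> (LINT x|\<mu>. 2 * c * ((1 - f x) * g x)) \<le> s"
    and "\<And>\<delta>. \<delta> > 0 \<Longrightarrow> \<exists>F s. test_bound X K F s \<and>
           s \<le> c * (measure \<mu> X + 1) \<and> (LINT x|\<mu>. \<bar>F x - f x\<bar>) \<le> \<delta>"
proof -
  interpret finite_measure \<mu> using fbmD(1)[OF \<mu>] .
  note sp = fbmD(3)[OF \<mu>]
  define adm where "adm F s \<longleftrightarrow> test_bound X K F s \<and> (\<forall>x\<in>X. F x \<le> 1)" for F s
  define E where "E F = (LINT x|\<mu>. (1 - F x)\<^sup>2)" for F :: "'a \<Rightarrow> real"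
  define J where "J = {s + c * E F | F s. adm F s}"
  define m where "m = Inf J"
  have E0: "0 \<le> E F" for F
    unfolding E_def by simp
  have int: "integrable \<mu> g" if "continuous_on X g" for g :: "'a \<Rightarrow> real"
    using continuous_on_imp_integrable_fbm[OF \<mu> that X] .
  have adm_cont: "continuous_on X F" if "adm F s" for F s
    using that by (auto simp: adm_def test_bound_def)
  have adm01: "0 \<le> F x" "F x \<le> 1" if "adm F s" "x \<in> X" for F s x
    using that by (auto simp: adm_def test_bound_def)
  have adm_s: "0 \<le> s" if "adm F s" for F s
    using that test_bound_nonneg[OF K] by (auto simp: adm_def)
  have bdd: "bdd_below J"
    using E0 adm_s c by (intro bdd_belowI[of _ 0]) (auto simp: J_def)
  have m_le: "m \<le> s + c * E F" if "adm F s" for F s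
    unfolding m_def using that bdd by (intro cInf_lower) (auto simp: J_def)
  have adm0: "adm (\<lambda>_. 0) 0"
    by (auto simp: adm_def test_bound_def)
  then have J_ne: "J \<noteq> {}" by (auto simp: J_def)
  have m_bound: "m \<le> c * measure \<mu> X"
    using m_le[OF adm0] by (simp add: E_def sp)
  have "\<exists>F s. adm F s \<and> s + c * E F < m + c * (1/8) ^ n" for n
  proof -
    have "\<exists>j\<in>J. j < m + c * (1/8) ^ n"
      using cInf_less_iff[OF J_ne bdd, of "m + c * (1/8) ^ n"] c by (simp add: m_def)
    then show ?thesis by (auto simp: J_def)
  qed
  then obtain F \<sigma> where adm: "\<And>n. adm (F n) (\<sigma> n)"
    and near: "\<And>n. \<sigma> n + c * E (F n) < m + c * (1/8) ^ n"
    by metis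
  note Fc = adm_cont[OF adm]
  note F01 = adm01[OF adm]
  have Fm[measurable]: "F n \<in> borel_measurable \<mu>" for n
    using continuous_on_imp_measurable_fbm[OF \<mu> Fc] .
  \<comment> \<open>Parallelogram law, with the midpoint of two consecutive near-minimisers as a competitor.\<close>
  have L2: "(LINT x|\<mu>. (F n x - F (Suc n) x)\<^sup>2) \<le> 4 * (1/8) ^ n" for n
  proof -
    let ?G = "\<lambda>x. (1/2) * F n x + (1/2) * F (Suc n) x"
    have "adm ?G ((1/2) * \<sigma> n + (1/2) * \<sigma> (Suc n))"
      using test_bound_combination[OF X K(1), of "F n" "\<sigma> n" "F (Suc n)" "\<sigma> (Suc n)" "1/2" "1/2"]
        adm[of n] adm[of "Suc n"] by (fastforce simp: adm_def)
    then have "m \<le> (1/2) * \<sigma> n + (1/2) * \<sigma> (Suc n) + c * E ?G"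
      by (rule m_le)
    moreover have "E ?G = E (F n) / 2 + E (F (Suc n)) / 2 - (LINT x|\<mu>. (F n x - F (Suc n) x)\<^sup>2) / 4"
    proof -
      have "E ?G = (LINT x|\<mu>. (1 - F n x)\<^sup>2 / 2 + (1 - F (Suc n) x)\<^sup>2 / 2 - (F n x - F (Suc n) x)\<^sup>2 / 4)"
        unfolding E_def
        by (intro Bochner_Integration.integral_cong refl) (simp add: power2_eq_square field_simps)
      also have "\<dots> = E (F n) / 2 + E (F (Suc n)) / 2 - (LINT x|\<mu>. (F n x - F (Suc n) x)\<^sup>2) / 4"
        unfolding E_def
        by (subst Bochner_Integration.integral_diff Bochner_Integration.integral_add;
            (intro int continuous_intros Fc)?; simp)+
      finally show ?thesis .
    qed
    ultimately have "m \<le> (1/2) * \<sigma> n + (1/2) * \<sigma> (Suc n)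
        + c * (E (F n) / 2 + E (F (Suc n)) / 2 - (LINT x|\<mu>. (F n x - F (Suc n) x)\<^sup>2) / 4)"
      by (simp only:)
    then have 1: "m \<le> (\<sigma> n + c * E (F n)) / 2 + (\<sigma> (Suc n) + c * E (F (Suc n))) / 2
        - c * ((LINT x|\<mu>. (F n x - F (Suc n) x)\<^sup>2) / 4)"
      by (simp add: algebra_simps add_divide_distrib)
    have 2: "c * (1/8) ^ Suc n \<le> c * (1/8) ^ n"
      using c by (intro mult_left_mono power_decreasing) auto
    have "D \<le> e" if "m \<le> a / 2 + b / 2 - D" "e' \<le> e" "a < m + e" "b < m + e'" for a b D e e' :: real
      using that by linarith
    from this[OF 1 2 near near]
    have "c * ((LINT x|\<mu>. (F n x - F (Suc n) x)\<^sup>2) / 4) \<le> c * (1/8) ^ n" .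
    then show ?thesis using c by simp
  qed
  have "AE x in \<mu>. convergent (\<lambda>n. F n x)"
  proof (rule AE_convergent_if_fast_L2_Cauchy[OF finite_measure_axioms])
    show "integrable \<mu> (F n)" for n by (rule int[OF Fc])
    show "integrable \<mu> (\<lambda>x. (F n x - F (Suc n) x)\<^sup>2)" for n
      by (intro int continuous_intros Fc)
  qed (rule L2)
  then have conv: "AE x in \<mu>. (\<lambda>n. F n x) \<longlonglongrightarrow> lim (\<lambda>n. F n x)"
    by (simp add: convergent_LIMSEQ_iff)
  \<comment> \<open>The truncation makes the bounds hold also on the null set where the sequence diverges.\<close>
  define f where "f x = max 0 (min 1 (lim (\<lambda>n. F n x)))" for x
  have fm[measurable]: "f \<in> borel_measurable \<mu>"
    unfolding f_def by measurable
  have f01: "0 \<le> f x" "f x \<le> 1" for x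
    by (auto simp: f_def)
  have Ff: "AE x in \<mu>. (\<lambda>n. F n x) \<longlonglongrightarrow> f x"
    using conv
  proof (rule AE_mp, intro AE_I2 impI)
    fix x assume "x \<in> space \<mu>" and *: "(\<lambda>n. F n x) \<longlonglongrightarrow> lim (\<lambda>n. F n x)"
    then have "x \<in> X" by (simp add: sp)
    then have "0 \<le> lim (\<lambda>n. F n x)" "lim (\<lambda>n. F n x) \<le> 1"
      using LIMSEQ_le_const[OF *, of 0] LIMSEQ_le_const2[OF *, of 1] F01 by blast+
    with * show "(\<lambda>n. F n x) \<longlonglongrightarrow> f x" by (simp add: f_def)
  qed
  have bound: "(LINT x|\<mu>. 2 * c * ((1 - f x) * g x)) \<le> s" if g: "test_bound X K g s" for g s
  proof (rule le_if_le_add_vanishing)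
    fix t :: real assume t: "0 < t" "t \<le> 1"
    have gc: "continuous_on X g" and g0: "\<And>x. x \<in> X \<Longrightarrow> 0 \<le> g x"
      using g by (auto simp: test_bound_def)
    have gm[measurable]: "g \<in> borel_measurable \<mu>"
      using continuous_on_imp_measurable_fbm[OF \<mu> gc] .
    have step: "(LINT x|\<mu>. 2 * c * ((1 - F n x) * g x))
        \<le> s + c * (1/8) ^ n / t + t * (c * (LINT x|\<mu>. (g x)\<^sup>2))" for n
    proof -
      \<comment> \<open>Cutting \<open>F\<^sub>n + t g\<close> off at \<open>1\<close> preserves its bound and does not increase the penalty.\<close>
      let ?G = "\<lambda>x. min 1 (1 * F n x + t * g x)"
      have "test_bound X K ?G (1 * \<sigma> n + t * s)"
        using adm[of n] g t by (intro test_bound_min_1 test_bound_combination X K(1)) (auto simp: adm_def)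
      then have "adm ?G (\<sigma> n + t * s)" by (simp add: adm_def)
      then have "m \<le> \<sigma> n + t * s + c * E ?G" by (rule m_le)
      also have "E ?G \<le> (LINT x|\<mu>. (1 - F n x)\<^sup>2 - 2 * t * ((1 - F n x) * g x) + t\<^sup>2 * (g x)\<^sup>2)"
        unfolding E_def
      proof (intro integral_mono int continuous_intros Fc gc)
        fix x assume "x \<in> space \<mu>"
        then have "x \<in> X" by (simp add: sp)
        have "(1 - F n x)\<^sup>2 - 2 * t * ((1 - F n x) * g x) + t\<^sup>2 * (g x)\<^sup>2 = (1 - F n x - t * g x)\<^sup>2"
          by (simp add: power2_eq_square algebra_simps)
        moreover have "(1 - ?G x)\<^sup>2 \<le> (1 - F n x - t * g x)\<^sup>2"
          by (cases "F n x + t * g x \<le> 1") (auto simp: min_def algebra_simps)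
        ultimately show "(1 - ?G x)\<^sup>2 \<le> (1 - F n x)\<^sup>2 - 2 * t * ((1 - F n x) * g x) + t\<^sup>2 * (g x)\<^sup>2"
          by simp
      qed
      also have "\<dots> = E (F n) - 2 * t * (LINT x|\<mu>. (1 - F n x) * g x) + t\<^sup>2 * (LINT x|\<mu>. (g x)\<^sup>2)"
        unfolding E_def
        by (subst Bochner_Integration.integral_diff Bochner_Integration.integral_add;
            (intro int continuous_intros Fc gc)?; simp)+
      finally have "m \<le> \<sigma> n + t * s + c * (E (F n) - 2 * t * (LINT x|\<mu>. (1 - F n x) * g x)
          + t\<^sup>2 * (LINT x|\<mu>. (g x)\<^sup>2))"
        using c by simp
      then have "t * (2 * c * (LINT x|\<mu>. (1 - F n x) * g x))
          \<le> t * s + c * (1/8) ^ n + t * (t * (c * (LINT x|\<mu>. (g x)\<^sup>2)))"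
        using near[of n] by (simp add: algebra_simps power2_eq_square)
      also have "\<dots> = t * (s + c * (1/8) ^ n / t + t * (c * (LINT x|\<mu>. (g x)\<^sup>2)))"
        using t by (simp add: field_simps)
      finally show ?thesis using t by simp
    qed
    have lim_bound: "(\<lambda>n. s + c * (1/8) ^ n / t + t * (c * (LINT x|\<mu>. (g x)\<^sup>2)))
        \<longlonglongrightarrow> s + c * 0 / t + t * (c * (LINT x|\<mu>. (g x)\<^sup>2))"
      by (intro tendsto_intros LIMSEQ_realpow_zero) (use t in auto)
    have lim_int: "(\<lambda>n. LINT x|\<mu>. 2 * c * ((1 - F n x) * g x)) \<longlonglongrightarrow> (LINT x|\<mu>. 2 * c * ((1 - f x) * g x))"
    proof (rule integral_dominated_convergence[where w = "\<lambda>x. 2 * c * g x"])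
      show "integrable \<mu> (\<lambda>x. 2 * c * g x)" by (intro int continuous_intros gc)
      show "AE x in \<mu>. (\<lambda>n. 2 * c * ((1 - F n x) * g x)) \<longlonglongrightarrow> 2 * c * ((1 - f x) * g x)"
        using Ff by (rule AE_mp) (auto intro!: AE_I2 tendsto_intros)
      show "AE x in \<mu>. norm (2 * c * ((1 - F n x) * g x)) \<le> 2 * c * g x" for n
        using c F01 g0 by (intro AE_I2) (simp add: sp abs_mult mult_left_le_one_le)
    qed measurable
    have "(LINT x|\<mu>. 2 * c * ((1 - f x) * g x)) \<le> s + c * 0 / t + t * (c * (LINT x|\<mu>. (g x)\<^sup>2))"
      by (rule LIMSEQ_le[OF lim_int lim_bound]) (use step in blast)
    then show "(LINT x|\<mu>. 2 * c * ((1 - f x) * g x)) \<le> s + t * (c * (LINT x|\<mu>. (g x)\<^sup>2))"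
      by simp
  qed
  have approx: "\<exists>F s. test_bound X K F s \<and>
      s \<le> c * (measure \<mu> X + 1) \<and> (LINT x|\<mu>. \<bar>F x - f x\<bar>) \<le> \<delta>" if \<delta>: "\<delta> > 0" for \<delta>
  proof -
    have "(\<lambda>n. LINT x|\<mu>. \<bar>F n x - f x\<bar>) \<longlonglongrightarrow> (LINT x|\<mu>. 0)"
    proof (rule integral_dominated_convergence[where w = "\<lambda>x. 1"])
      show "AE x in \<mu>. (\<lambda>n. \<bar>F n x - f x\<bar>) \<longlonglongrightarrow> 0"
        using Ff by (rule AE_mp) (auto intro!: AE_I2 tendsto_rabs_zero LIM_zero)
      show "AE x in \<mu>. norm \<bar>F n x - f x\<bar> \<le> 1" for n
      proof (rule AE_I2)
        fix x assume "x \<in> space \<mu>"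
        then show "norm \<bar>F n x - f x\<bar> \<le> 1"
          using F01[of x n] f01[of x] by (simp add: sp abs_le_iff)
      qed
    qed auto
    then have "\<forall>\<^sub>F n in sequentially. (LINT x|\<mu>. \<bar>F n x - f x\<bar>) < \<delta>"
      using \<delta> by (intro order_tendstoD(2)) auto
    then obtain n where n: "(LINT x|\<mu>. \<bar>F n x - f x\<bar>) < \<delta>"
      by (auto simp: eventually_sequentially)
    have "c * (1/8) ^ n \<le> c * 1"
      using c by (intro mult_left_mono power_le_one) auto
    moreover have "0 \<le> c * E (F n)" using c E0 by simp
    ultimately have "\<sigma> n \<le> c * (measure \<mu> X + 1)"
      using near[of n] m_bound by (simp add: distrib_left)
    then show ?thesis
      using n adm[of n] by (intro exI[of _ "F n"] exI[of _ "\<sigma> n"]) (auto simp: adm_def)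
  qed
  show thesis
    using that[OF fm f01 bound approx] by blast
qed

section \<open>A strictly positive density\<close>

lemma series_half_weights:
  fixes a :: "nat \<Rightarrow> real"
  assumes "\<And>k. 0 \<le> a k" "\<And>k. a k \<le> 1"
  shows "summable (\<lambda>k. (1/2) ^ Suc k * a k)" "(\<Sum>k. (1/2) ^ Suc k * a k) \<le> 1"
proof -
  show s: "summable (\<lambda>k. (1/2) ^ Suc k * a k)"
    by (rule summable_comparison_test'[OF sums_summable[OF power_half_series], of 0])
       (use assms in \<open>auto simp: abs_mult intro!: mult_left_le\<close>)
  have "(\<Sum>k. (1/2) ^ Suc k * a k) \<le> (\<Sum>k. (1/2) ^ Suc k)"
    by (intro suminf_le s sums_summable[OF power_half_series] mult_left_le assms) simp
  then show "(\<Sum>k. (1/2) ^ Suc k * a k) \<le> 1"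
    using sums_unique[OF power_half_series] by simp
qed

text \<open>Every measure in \<open>K\<close> integrates the series \<open>\<Sum>F\<^sub>k\<close> to at most \<open>\<Sum>s\<^sub>k < \<infinity>\<close>. This is how the
  hypothesis on null sets, which involves all of \<open>K\<close> at once, becomes accessible to countably many
  continuous functions.\<close>

lemma null_for_series_diverges:
  assumes X: "compact X" and K: "K \<subseteq> finite_borel_measures X"
    and F: "\<And>k. test_bound X K (F k) (s k)" and s: "summable s"
  shows "null_for X K {x \<in> X. (\<Sum>k. ennreal (F k x)) = \<infinity>}"
proof -
  have Fc: "continuous_on X (F k)" for k
    using F by (simp add: test_bound_def)
  have [measurable]: "F k \<in> borel_measurable (restrict_space borel X)" for k
    using borel_measurable_continuous_on_restrict[OF Fc] .
  let ?A = "{x \<in> X. (\<Sum>k. ennreal (F k x)) = \<infinity>}"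
  have "{x \<in> space (restrict_space borel X). (\<Sum>k. ennreal (F k x)) = \<infinity>}
      \<in> sets (restrict_space borel X)"
    by measurable
  then have A: "?A \<in> sets (restrict_space borel X)"
    by (simp add: space_restrict_space)
  have "emeasure \<tau> ?A = 0" if \<tau>: "\<tau> \<in> K" for \<tau>
  proof -
    have \<tau>': "\<tau> \<in> finite_borel_measures X" using K \<tau> by blast
    have "AE x in \<tau>. (\<Sum>k. ennreal (F k x)) \<noteq> \<infinity>"
    proof (rule AE_summable_if_integrals_summable(1))
      show "integrable \<tau> (F k)" for k
        by (rule continuous_on_imp_integrable_fbm[OF \<tau>' Fc X])
      show "0 \<le> F k x" if "x \<in> space \<tau>" for k x
        using F that by (simp add: test_bound_def fbmD(3)[OF \<tau>'])
      show "(LINT x|\<tau>. F k x) \<le> s k" for k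
        using F \<tau> by (simp add: test_bound_def)
    qed (rule s)
    then show ?thesis
      using A by (subst (asm) AE_iff_measurable[where N = ?A]) (simp_all add: fbmD[OF \<tau>'])
  qed
  with A show ?thesis by (simp add: null_for_def)
qed

text \<open>Use \<open>test_bounded_density\<close> with \<open>c = 2\<^sup>-\<^sup>k / 2\<close> for each \<open>k\<close>. As \<open>c \<rightarrow> 0\<close> the penalty on \<open>1 - F\<close> loses
  weight and the minimisers become small, so fast that \<open>\<Sum>F\<^sub>k\<close> converges outside a \<open>K\<close>-null set.
  Hence the densities \<open>2\<^sup>-\<^sup>k (1 - f\<^sub>k)\<close> are eventually positive at almost every point, and their sum with
  weights \<open>2\<^sup>-\<^sup>k\<^sup>-\<^sup>1\<close> is positive almost everywhere.\<close>

lemma strictly_positive_density_in_K: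
  assumes X: "compact X" and K: "K \<subseteq> finite_borel_measures X" "K \<noteq> {}"
    and conv: "convex_measures K" and closed: "closedin (weak_measure_topology X) K"
    and hered: "\<And>\<nu> \<tau>. \<nu> \<in> K \<Longrightarrow> \<tau> \<in> finite_borel_measures X \<Longrightarrow> \<tau> \<le> \<nu> \<Longrightarrow> \<tau> \<in> K"
    and \<mu>: "\<mu> \<in> finite_borel_measures X"
    and null: "\<And>A. null_for X K A \<Longrightarrow> emeasure \<mu> A = 0"
  obtains h :: "'a::topological_space \<Rightarrow> real" where "h \<in> borel_measurable \<mu>"
    and "\<And>x. 0 \<le> h x" and "\<And>x. h x \<le> 1"
    and "AE x in \<mu>. 0 < h x" and "density \<mu> h \<in> K"
proof -
  interpret finite_measure \<mu> using fbmD(1)[OF \<mu>] .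
  define C where "C = measure \<mu> X + 1"
  define good where "good k f F s \<longleftrightarrow> f \<in> borel_measurable \<mu> \<and> (\<forall>x. 0 \<le> f x) \<and> (\<forall>x. f x \<le> 1) \<and>
      (\<forall>g s. test_bound X K g s \<longrightarrow> (LINT x|\<mu>. (1/2) ^ k * ((1 - f x) * g x)) \<le> s) \<and>
      test_bound X K F s \<and> s \<le> C * (1/2) ^ k \<and>
      (LINT x|\<mu>. \<bar>F x - f x\<bar>) \<le> (1/2) ^ k" for k f F s
  have "\<exists>f F s. good k f F s" for k
  proof -
    have c: "(0::real) < (1/2) ^ k / 2" by simp
    obtain f where f: "f \<in> borel_measurable \<mu>" "\<And>x. 0 \<le> f x" "\<And>x. f x \<le> 1"
      and fK: "\<And>g s. test_bound X K g s \<Longrightarrow> (LINT x|\<mu>. 2 * ((1/2) ^ k / 2) * ((1 - f x) * g x)) \<le> s"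
      and ap: "\<And>\<delta>. \<delta> > 0 \<Longrightarrow> \<exists>F s. test_bound X K F s \<and>
           s \<le> (1/2) ^ k / 2 * (measure \<mu> X + 1) \<and> (LINT x|\<mu>. \<bar>F x - f x\<bar>) \<le> \<delta>"
      using test_bounded_density[OF X K \<mu> c] by blast
    obtain F s where F: "test_bound X K F s"
      "s \<le> (1/2) ^ k / 2 * (measure \<mu> X + 1)" "(LINT x|\<mu>. \<bar>F x - f x\<bar>) \<le> (1/2) ^ k"
      using ap[of "(1/2) ^ k"] by auto
    have "(1/2) ^ k / 2 * (measure \<mu> X + 1) \<le> (1/2) ^ k * (measure \<mu> X + 1)"
      by (intro mult_right_mono) auto
    then have "s \<le> C * (1/2) ^ k"
      using F(2) unfolding C_def by (simp only: mult.commute)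
    moreover have "(LINT x|\<mu>. (1/2) ^ k * ((1 - f x) * g x)) \<le> s" if "test_bound X K g s" for g s
      using fK[OF that] by simp
    ultimately show ?thesis
      using f F unfolding good_def by blast
  qed
  then obtain f F s where good: "\<And>k. good k (f k) (F k) (s k)" by metis
  then have f[measurable]: "\<And>k. f k \<in> borel_measurable \<mu>"
    and f01: "\<And>k x. 0 \<le> f k x" "\<And>k x. f k x \<le> 1"
    and fK: "\<And>k g s. test_bound X K g s \<Longrightarrow> (LINT x|\<mu>. (1/2) ^ k * ((1 - f k x) * g x)) \<le> s"
    and F: "\<And>k. test_bound X K (F k) (s k)"
    and s: "\<And>k. s k \<le> C * (1/2) ^ k"
    and Ff: "\<And>k. (LINT x|\<mu>. \<bar>F k x - f k x\<bar>) \<le> (1/2) ^ k"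
    unfolding good_def by blast+
  define a where "a k x = (1/2) ^ k * (1 - f k x)" for k x
  have a01: "0 \<le> a k x" "a k x \<le> 1" for k x
    using f01 by (auto simp: a_def intro!: mult_le_one power_le_one)
  have am[measurable]: "a k \<in> borel_measurable \<mu>" for k
    unfolding a_def by measurable
  define h where "h x = (\<Sum>k. (1/2) ^ Suc k * a k x)" for x
  have h_sum: "summable (\<lambda>k. (1/2) ^ Suc k * a k x)" and h1: "h x \<le> 1" for x
    using series_half_weights[of "\<lambda>k. a k x"] a01 by (auto simp: h_def)
  have h0: "0 \<le> h x" for x
    unfolding h_def by (intro suminf_nonneg h_sum mult_nonneg_nonneg a01) simp
  have hm[measurable]: "h \<in> borel_measurable \<mu>"
    unfolding h_def by measurable

  have "density \<mu> h \<in> K"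
  proof (rule mem_if_test_bounds[OF X K conv closed])
    show "\<tau> \<in> K" if "\<nu> \<in> K" "\<tau> \<in> finite_borel_measures X" "\<tau> \<le> \<nu>" for \<nu> \<tau>
      using hered that .
    show "density \<mu> h \<in> finite_borel_measures X"
      using density_in_fbm[OF \<mu> hm h0 h1] .
    fix g s assume g: "test_bound X K g s"
    then have gc: "continuous_on X g" and g0: "\<And>x. x \<in> X \<Longrightarrow> 0 \<le> g x"
      by (auto simp: test_bound_def)
    have gm[measurable]: "g \<in> borel_measurable \<mu>"
      using continuous_on_imp_measurable_fbm[OF \<mu> gc] .
    have gi: "integrable \<mu> g" using continuous_on_imp_integrable_fbm[OF \<mu> gc X] .
    have s0: "0 \<le> s" by (rule test_bound_nonneg[OF K g])
    have ai: "integrable \<mu> (\<lambda>x. a k x * g x)" for k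
      by (rule Bochner_Integration.integrable_bound[OF gi])
         (use a01 in \<open>auto intro!: AE_I2 mult_left_le_one_le simp: abs_mult\<close>)
    have ag: "(LINT x|\<mu>. a k x * g x) \<le> s" for k
      using fK[OF g, of k] by (simp add: a_def mult.assoc)
    have ag0: "0 \<le> (LINT x|\<mu>. a k x * g x)" for k
      using a01 g0 by (intro Bochner_Integration.integral_nonneg mult_nonneg_nonneg) (auto simp: fbmD(3)[OF \<mu>])
    have nrm: "(LINT x|\<mu>. norm ((1/2) ^ Suc k * (a k x * g x))) = (1/2) ^ Suc k * (LINT x|\<mu>. a k x * g x)" for k
    proof -
      have "(LINT x|\<mu>. norm ((1/2) ^ Suc k * (a k x * g x))) = (LINT x|\<mu>. (1/2) ^ Suc k * (a k x * g x))"
        using a01 g0 by (intro Bochner_Integration.integral_cong refl)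
          (auto simp: fbmD(3)[OF \<mu>] abs_mult)
      then show ?thesis by simp
    qed
    have sum_s: "summable (\<lambda>k. (1/2) ^ Suc k * (s :: real))"
      by (intro summable_mult2 sums_summable[OF power_half_series])
    have sum_i: "summable (\<lambda>k. (1/2) ^ Suc k * (LINT x|\<mu>. a k x * g x))"
      by (rule summable_comparison_test'[OF sum_s, of 0])
         (use ag ag0 in \<open>auto simp: abs_mult intro!: mult_left_mono\<close>)
    have "(LINT x|density \<mu> h. g x) = (LINT x|\<mu>. h x * g x)"
      using h0 by (subst integral_density) auto
    also have "\<dots> = (LINT x|\<mu>. (\<Sum>k. (1/2) ^ Suc k * (a k x * g x)))"
      unfolding h_def
      by (intro Bochner_Integration.integral_cong refl)
         (simp only: suminf_mult2[OF h_sum] mult.assoc)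
    also have "\<dots> = (\<Sum>k. LINT x|\<mu>. (1/2) ^ Suc k * (a k x * g x))"
    proof (rule integral_suminf)
      show "integrable \<mu> (\<lambda>x. (1/2) ^ Suc k * (a k x * g x))" for k
        by (intro integrable_mult_right ai)
      show "AE x in \<mu>. summable (\<lambda>k. norm ((1/2) ^ Suc k * (a k x * g x)))"
      proof (rule AE_I2)
        fix x
        have "summable (\<lambda>k. (1/2) ^ Suc k * a k x * \<bar>g x\<bar>)"
          by (intro summable_mult2 h_sum)
        then show "summable (\<lambda>k. norm ((1/2) ^ Suc k * (a k x * g x)))"
          using a01 by (simp add: abs_mult mult.assoc)
      qed
      show "summable (\<lambda>k. LINT x|\<mu>. norm ((1/2) ^ Suc k * (a k x * g x)))"
        unfolding nrm by (rule sum_i)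
    qed
    also have "\<dots> = (\<Sum>k. (1/2) ^ Suc k * (LINT x|\<mu>. a k x * g x))"
      by simp
    also have "\<dots> \<le> (\<Sum>k. (1/2) ^ Suc k * s)"
      by (intro suminf_le sum_i sum_s mult_left_mono ag) simp
    also have "\<dots> = s"
      using sums_unique[OF sums_mult2[OF power_half_series, of s]] by simp
    finally show "(LINT x|density \<mu> h. g x) \<le> s" .
  qed

  moreover have "AE x in \<mu>. 0 < h x"
  proof -
    have s_sum: "summable s"
      by (rule summable_comparison_test'[of "\<lambda>k. C * (1/2) ^ k" 0])
         (use s test_bound_nonneg[OF K F] in \<open>auto intro!: summable_mult summable_geometric\<close>)
    let ?A = "{x \<in> X. (\<Sum>k. ennreal (F k x)) = \<infinity>}"
    have nullA: "null_for X K ?A"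
      by (rule null_for_series_diverges[OF X K(1) F s_sum])
    then have "?A \<in> null_sets \<mu>"
      using null[OF nullA] by (auto simp: null_for_def fbmD(2)[OF \<mu>] null_sets_def)
    then have "AE x in \<mu>. x \<notin> ?A" by (rule AE_not_in)
    moreover have "AE x in \<mu>. summable (\<lambda>k. \<bar>F k x - f k x\<bar>)"
    proof (rule AE_summable_if_integrals_summable(2)[OF _ _ Ff])
      show "integrable \<mu> (\<lambda>x. \<bar>F k x - f k x\<bar>)" for k
      proof (intro integrable_abs Bochner_Integration.integrable_diff)
        show "integrable \<mu> (F k)"
          using F by (intro continuous_on_imp_integrable_fbm[OF \<mu> _ X]) (simp add: test_bound_def)
        show "integrable \<mu> (f k)"
          using f01 by (intro integrable_const_bound[of _ 1]) auto
      qed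
    qed (auto intro!: summable_geometric)
    moreover have "AE x in \<mu>. x \<in> X"
      by (rule AE_I2) (simp add: fbmD(3)[OF \<mu>])
    ultimately show ?thesis
    proof eventually_elim
      case (elim x)
      have "0 \<le> F k x" for k
        using F elim(3) by (auto simp: test_bound_def)
      then have "summable (\<lambda>k. F k x)"
        using elim(1,3) by (intro summable_suminf_not_top) auto
      from tendsto_diff[OF summable_LIMSEQ_zero[OF this]
          summable_LIMSEQ_zero[OF summable_rabs_cancel[OF elim(2)]]]
      have "(\<lambda>k. f k x) \<longlonglongrightarrow> 0" by simp
      \<comment> \<open>One index with \<open>f\<^sub>k(x) < 1\<close> is enough for \<open>h(x) > 0\<close>.\<close>
      then have "\<forall>\<^sub>F k in sequentially. f k x < 1"
        by (rule order_tendstoD(2)) simp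
      then obtain k where "f k x < 1"
        by (auto simp: eventually_sequentially)
      then have "0 < (1/2) ^ Suc k * a k x" by (simp add: a_def)
      then show "0 < h x"
        unfolding h_def
        by (intro suminf_pos2[OF h_sum, of _ k]) (auto intro: mult_nonneg_nonneg a01)
    qed
  qed
  ultimately show thesis using that[OF hm h0 h1] by blast
qed

section \<open>Approximation from below by multiples of members of \<open>K\<close>\<close>

theorem theorem2p1:
  fixes X :: "'a::metric_space set" and K :: "'a measure set" and \<mu> :: "'a measure"
  assumes "compact X"
    and "K \<subseteq> finite_borel_measures X"
    and "K \<noteq> {}" and "convex_measures K" and "closedin (weak_measure_topology X) K"
    and "\<And>\<nu> \<tau>. \<nu> \<in> K \<Longrightarrow> \<tau> \<in> finite_borel_measures X \<Longrightarrow> \<tau> \<le> \<nu> \<Longrightarrow> \<tau> \<in> K"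
    and "\<mu> \<in> finite_borel_measures X"
    and "\<And>A. null_for X K A \<Longrightarrow> emeasure \<mu> A = 0"
  shows "\<exists>\<nu> :: nat \<Rightarrow> 'a measure.
    (\<forall>n\<ge>1. \<nu> n \<in> K \<and> scale_measure (of_nat n) (\<nu> n) \<in> finite_borel_measures X) \<and>
    mono_on {1..} (\<lambda>n. scale_measure (of_nat n) (\<nu> n)) \<and>
    \<mu> = (SUP n\<in>{1..}. scale_measure (of_nat n) (\<nu> n))"
proof -
  note \<mu> = \<open>\<mu> \<in> finite_borel_measures X\<close>
  obtain h :: "'a \<Rightarrow> real" where hm[measurable]: "h \<in> borel_measurable \<mu>"
    and h0: "\<And>x. 0 \<le> h x" and h1: "\<And>x. h x \<le> 1"
    and hpos: "AE x in \<mu>. 0 < h x" and hK: "density \<mu> h \<in> K"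
    by (rule strictly_positive_density_in_K[OF assms(1-5) _ \<mu>])
       (erule (2) assms(6) | erule assms(8) | rule that; assumption)+
  define \<nu> where "\<nu> n = density \<mu> (\<lambda>x. ennreal (min (h x) (1 / real n)))" for n
  have scaled: "scale_measure (of_nat n) (\<nu> n) = density \<mu> (\<lambda>x. ennreal (min (real n * h x) 1))"
    if n: "n \<ge> 1" for n
  proof (rule measure_eqI)
    fix A assume "A \<in> sets (scale_measure (of_nat n) (\<nu> n))"
    then have A[measurable]: "A \<in> sets \<mu>" by (simp add: \<nu>_def)
    have "of_nat n * ennreal (min (h x) (1 / real n)) = ennreal (min (real n * h x) 1)" for x
    proof -
      have "real n * min (h x) (1 / real n) = min (real n * h x) 1"
        using n by (auto simp: min_def field_simps)
      moreover have "of_nat n * ennreal (min (h x) (1 / real n)) = ennreal (real n * min (h x) (1 / real n))"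
        by (simp only: ennreal_mult'[OF of_nat_0_le_iff] ennreal_of_nat_eq_real_of_nat)
      ultimately show ?thesis by (simp only:)
    qed
    then show "emeasure (scale_measure (of_nat n) (\<nu> n)) A
        = emeasure (density \<mu> (\<lambda>x. ennreal (min (real n * h x) 1))) A"
      by (simp add: \<nu>_def emeasure_density nn_integral_cmult[symmetric] mult.assoc[symmetric])
  qed (simp add: \<nu>_def)
  have \<nu>K: "\<nu> n \<in> K" if "n \<ge> 1" for n
  proof (rule assms(6)[OF hK])
    show "\<nu> n \<in> finite_borel_measures X"
      unfolding \<nu>_def
      by (rule density_in_fbm[OF \<mu>, of _ 1]) (use h0 h1 in \<open>auto intro: min.coboundedI1\<close>)
    show "\<nu> n \<le> density \<mu> h"
      unfolding \<nu>_def by (rule density_mono_fbm[OF \<mu>, of _ _ 1]) (use h0 h1 in auto)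
  qed
  have fin: "scale_measure (of_nat n) (\<nu> n) \<in> finite_borel_measures X" if "n \<ge> 1" for n
    unfolding scaled[OF that]
    by (rule density_in_fbm[OF \<mu>, of _ 1]) (use h0 in auto)
  have mono: "mono_on {1..} (\<lambda>n. scale_measure (of_nat n) (\<nu> n))"
  proof (rule mono_onI)
    fix m n :: nat assume mn: "m \<in> {1..}" "n \<in> {1..}" "m \<le> n"
    have le: "min (real m * h x) 1 \<le> min (real n * h x) 1" for x
      using mn(3) by (intro min.mono mult_right_mono h0) auto
    have "density \<mu> (\<lambda>x. ennreal (min (real m * h x) 1)) \<le> density \<mu> (\<lambda>x. ennreal (min (real n * h x) 1))"
      by (rule density_mono_fbm[OF \<mu>, of _ _ 1])
         (rule borel_measurable_min borel_measurable_times borel_measurable_const hm le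
           min.boundedI mult_nonneg_nonneg of_nat_0_le_iff h0 zero_le_one min.cobounded2)+
    then show "scale_measure (of_nat m) (\<nu> m) \<le> scale_measure (of_nat n) (\<nu> n)"
      using mn by (simp add: scaled)
  qed
  have "\<mu> = (SUP n\<in>{1..}. scale_measure (of_nat n) (\<nu> n))"
  proof (rule measure_eqI)
    have "sets (SUP n\<in>{1..}. scale_measure (of_nat n) (\<nu> n)) = sets \<mu>"
      by (rule sets_SUP) (auto simp: \<nu>_def)
    then show "sets \<mu> = sets (SUP n\<in>{1..}. scale_measure (of_nat n) (\<nu> n))" ..
    fix A assume A[measurable]: "A \<in> sets \<mu>"
    \<comment> \<open>Indices are shifted by one because the supremum starts at \<open>n = 1\<close>.\<close>
    let ?d = "\<lambda>n x. ennreal (min (real (Suc n) * h x) 1) * indicator A x"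
    have d_mono: "incseq ?d"
      unfolding incseq_def le_fun_def
      by (intro allI impI mult_right_mono ennreal_leI min.mono mult_right_mono h0) auto
    have limit: "AE x in \<mu>. indicator A x = (SUP n. ?d n x)"
      using hpos
    proof eventually_elim
      case (elim x)
      obtain N where "1 < real N * h x" using reals_Archimedean3[OF elim] by blast
      also have "real N * h x \<le> real (Suc N) * h x" using h0 by (intro mult_right_mono) auto
      finally have "?d N x = indicator A x" by (simp add: min_def)
      moreover have "?d N x \<le> (SUP n. ?d n x)" by (rule SUP_upper) simp
      ultimately have "indicator A x \<le> (SUP n. ?d n x)" by (simp only:)
      moreover have "(SUP n. ?d n x) \<le> indicator A x"
        by (intro SUP_least) (auto simp: indicator_def)
      ultimately show ?case by (rule antisym)
    qed
    have "emeasure \<mu> A = (\<integral>\<^sup>+x. indicator A x \<partial>\<mu>)"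
      by simp
    also have "\<dots> = (\<integral>\<^sup>+x. (SUP n. ?d n x) \<partial>\<mu>)"
      by (rule nn_integral_cong_AE[OF limit])
    also have "\<dots> = (SUP n. \<integral>\<^sup>+x. ?d n x \<partial>\<mu>)"
      by (rule nn_integral_monotone_convergence_SUP[OF d_mono]) measurable
    also have "\<dots> = (SUP n. emeasure (scale_measure (of_nat (Suc n)) (\<nu> (Suc n))) A)"
      by (subst scaled) (simp_all add: emeasure_density)
    also have "\<dots> = (SUP n\<in>{1..}. emeasure (scale_measure (of_nat n) (\<nu> n)) A)"
    proof -
      have "{1..} = range Suc" by (auto simp: image_iff Suc_le_eq gr0_conv_Suc)
      then show ?thesis by (simp only: image_image)
    qed
    also have "\<dots> = emeasure (SUP n\<in>{1..}. scale_measure (of_nat n) (\<nu> n)) A"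
      by (rule emeasure_SUP_finite_borel_measures[OF fin mono, symmetric])
         (use A in \<open>simp_all add: fbmD(2)[OF \<mu>]\<close>)
    finally show "emeasure \<mu> A = emeasure (SUP n\<in>{1..}. scale_measure (of_nat n) (\<nu> n)) A" .
  qed
  then show ?thesis
    using \<nu>K fin mono by blast
qed

end
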